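(* Let $\gamma>0$ and let $F$ be a free holomorphic function on $[B(\mathcal{H})^n]_\gamma$ with coefficients in $B(\mathcal{K})$ and with the representation $$F(X_1,\ldots,X_n)=\sum_{k=0}^\infty\Big(\sum_{|\alpha|=k}A_{(\alpha)}\otimes X_\alpha\Big),$$ and define $M(\rho):=\|F(\rho S_1,\ldots,\rho S_n)\|$ for any $\rho\in(0,\gamma)$, where $S_1,\ldots,S_n$ are the left creation operators on the full Fock space. Then, for each $k=0,1,\ldots$ and each $\rho\in(0,\gamma)$, $$\Big\|\sum_{|\alpha|=k}A_{(\alpha)}^*A_{(\alpha)}\Big\|^{1/2}\le\frac1{\rho^k}M(\rho).$$
   Context: $\mathbb{F}_n^+$ is the unital free semigroup on generators $g_1,\ldots,g_n$ with identity $g_0$; $|\alpha|$ is word length; $X_\alpha:=X_{i_1}\cdots X_{i_k}$ if $\alpha=g_{i_1}\cdots g_{i_k}$ and $X_{g_0}:=I$. $\mathcal{H},\mathcal{K}$ are Hilbert spaces and $[B(\mathcal{H})^n]_\gamma:=\{[X_1,\ldots,X_n]\in B(\mathcal{H})^n:\ \|X_1X_1^*+\cdots+X_nX_n^*\|^{1/2}<\gamma\}$. A free holomorphic function on $[B(\mathcal{H})^n]_\gamma$ with coefficients in $B(\mathcal{K})$ is a map $F(X_1,\ldots,X_n)=\sum_{k=0}^\infty\sum_{|\alpha|=k}A_{(\alpha)}\otimes X_\alpha\in B(\mathcal{K}\otimes\mathcal{H})$ with $A_{(\alpha)}\in B(\mathcal{K})$ such that the power series $\sum_\alpha A_{(\alpha)}\otimes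 Z_\alpha$ has radius of convergence $\ge\gamma$, i.e. $\limsup_{k\to\infty}\|\sum_{|\alpha|=k}A_{(\alpha)}^*A_{(\alpha)}\|^{1/2k}\le1/\gamma$. The series then converges in norm for $n$-tuples in the open ball of radius $\gamma$ on any Hilbert space, and this defines $F(\rho S_1,\ldots,\rho S_n)=\sum_k\sum_{|\alpha|=k}\rho^kA_{(\alpha)}\otimes S_\alpha$. The full Fock space is $F^2(H_n)=\mathbb{C}1\oplus\bigoplus_{m\ge1}H_n^{\otimes m}$, where $H_n$ is an $n$-dimensional Hilbert space with orthonormal basis $e_1,\ldots,e_n$; the left creation operators are $S_i\xi:=e_i\otimes\xi$. *)

theory Defs
  imports "HOL-Analysis.Analysis"
begin

section \<open>Complex Hilbert spaces\<close>

text \<open>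
  A complex inner product space carries the real inner product \<open>Re (cinner x y)\<close>, so it is
  presented as a refinement of \<^class>\<open>real_inner\<close>; norm, topology and completeness are
  the library's. The form \<open>cinner\<close> is linear in its first argument.
\<close>

class complex_inner = real_inner +
  fixes scaleC :: "complex \<Rightarrow> 'a \<Rightarrow> 'a"  (infixr \<open>*\<^sub>C\<close> 75)
    and cinner :: "'a \<Rightarrow> 'a \<Rightarrow> complex"
  assumes scaleC_add_right: "c *\<^sub>C (x + y) = c *\<^sub>C x + c *\<^sub>C y"
    and scaleC_add_left: "(c + d) *\<^sub>C x = c *\<^sub>C x + d *\<^sub>C x"
    and scaleC_scaleC: "c *\<^sub>C d *\<^sub>C x = (c * d) *\<^sub>C x"
    and scaleC_of_real: "complex_of_real r *\<^sub>C x = r *\<^sub>R x"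
    and cinner_commute: "cinner x y = cnj (cinner y x)"
    and cinner_add_left: "cinner (x + y) z = cinner x z + cinner y z"
    and cinner_scaleC_left: "cinner (c *\<^sub>C x) y = c * cinner x y"
    and Re_cinner: "Re (cinner x y) = inner x y"

class chilbert_space = complex_inner + banach

lemma cinner_add_right: "cinner x (y + z) = cinner x y + cinner (x::'a::complex_inner) z"
  by (metis cinner_add_left cinner_commute complex_cnj_add)

lemma cinner_scaleC_right: "cinner x (c *\<^sub>C y) = cnj c * cinner (x::'a::complex_inner) y"
  by (metis cinner_scaleC_left cinner_commute complex_cnj_mult)

lemma cinner_zero_left: "cinner 0 (y::'a::complex_inner) = 0"
  using cinner_add_left[of 0 0 y] by simp

lemma cinner_zero_right: "cinner (y::'a::complex_inner) 0 = 0"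
  using cinner_add_right[of y 0 0] by simp

lemma scaleC_one: "1 *\<^sub>C (x::'a::complex_inner) = x"
  using scaleC_of_real[of 1 x] by simp

lemma scaleC_zero_right: "c *\<^sub>C (0::'a::complex_inner) = 0"
  using scaleC_add_right[of c 0 0] by simp

lemma cinner_self: "cinner x x = complex_of_real ((norm (x::'a::complex_inner))\<^sup>2)"
proof (rule complex_eqI)
  show "Re (cinner x x) = Re (complex_of_real ((norm x)\<^sup>2))"
    by (simp only: Re_cinner power2_norm_eq_inner Re_complex_of_real)
  have "Im (cinner x x) = - Im (cinner x x)"
    using arg_cong[OF cinner_commute[of x x], of Im] by simp
  then show "Im (cinner x x) = Im (complex_of_real ((norm x)\<^sup>2))"
    by simp
qed

lemma norm_scaleC: "norm (c *\<^sub>C (x::'a::complex_inner)) = cmod c * norm x"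
proof -
  have "complex_of_real ((norm (c *\<^sub>C x))\<^sup>2) = c * cnj c * cinner x x"
    unfolding cinner_self[symmetric] by (simp add: cinner_scaleC_left cinner_scaleC_right)
  also have "\<dots> = complex_of_real ((cmod c * norm x)\<^sup>2)"
    by (simp add: cinner_self complex_norm_square[symmetric] power_mult_distrib)
  finally have "(norm (c *\<^sub>C x))\<^sup>2 = (cmod c * norm x)\<^sup>2"
    using of_real_eq_iff by blast
  then show ?thesis by simp
qed

lemma cinner_Cauchy_Schwarz: "cmod (cinner x y) \<le> norm x * norm (y::'a::complex_inner)"
proof (cases "cinner x y = 0")
  case False
  define c where "c = cnj (cinner x y) / complex_of_real (cmod (cinner x y))"
  have c: "cmod c = 1" using False by (simp add: c_def norm_divide)
  have "cinner (c *\<^sub>C x) y = complex_of_real (cmod (cinner x y))"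
    using False complex_norm_square[of "cinner x y"]
    by (simp add: cinner_scaleC_left c_def field_simps power2_eq_square)
  then have "cmod (cinner x y) = inner (c *\<^sub>C x) y"
    by (metis Re_cinner Re_complex_of_real)
  also have "\<dots> \<le> norm (c *\<^sub>C x) * norm y" by (rule norm_cauchy_schwarz)
  finally show ?thesis by (simp add: norm_scaleC c)
qed simp

instantiation complex :: chilbert_space
begin
definition scaleC_complex :: "complex \<Rightarrow> complex \<Rightarrow> complex" where "scaleC_complex = (*)"
definition cinner_complex :: "complex \<Rightarrow> complex \<Rightarrow> complex" where "cinner_complex x y = x * cnj y"
instance
  by standard (simp_all add: scaleC_complex_def cinner_complex_def algebra_simps
      scaleR_conv_of_real inner_complex_def)
end

section \<open>Square summable families and the full Fock space\<close>

typedef (overloaded) ('i, 'a::chilbert_space) ell2 =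
  "{f :: 'i \<Rightarrow> 'a. (\<lambda>i. (norm (f i))\<^sup>2) summable_on UNIV}"
  morphisms coord Abs_ell2
  by (rule exI[of _ "\<lambda>_. 0"]) simp

setup_lifting type_definition_ell2

lemma square_summable_add:
  fixes f g :: "'i \<Rightarrow> 'a::real_inner"
  assumes "(\<lambda>i. (norm (f i))\<^sup>2) summable_on UNIV" "(\<lambda>i. (norm (g i))\<^sup>2) summable_on UNIV"
  shows "(\<lambda>i. (norm (f i + g i))\<^sup>2) summable_on UNIV"
proof (rule summable_on_comparison_test)
  show "(\<lambda>i. 2 * (norm (f i))\<^sup>2 + 2 * (norm (g i))\<^sup>2) summable_on UNIV"
    by (intro summable_on_add summable_on_cmult_right assms)
  show "(norm (f i + g i))\<^sup>2 \<le> 2 * (norm (f i))\<^sup>2 + 2 * (norm (g i))\<^sup>2" for i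
  proof -
    have "(norm (f i + g i))\<^sup>2 \<le> (norm (f i) + norm (g i))\<^sup>2"
      by (simp add: norm_triangle_ineq)
    also have "\<dots> \<le> 2 * (norm (f i))\<^sup>2 + 2 * (norm (g i))\<^sup>2"
      using sum_squares_bound[of "norm (f i)" "norm (g i)"] by (simp add: power2_sum)
    finally show ?thesis .
  qed
qed simp

lemma square_summable_scale:
  assumes "(\<lambda>i. (norm (f i))\<^sup>2) summable_on UNIV"
  shows "(\<lambda>i. (norm (c *\<^sub>C (f i :: 'a::complex_inner)))\<^sup>2) summable_on UNIV"
  using summable_on_cmult_right[OF assms, of "(cmod c)\<^sup>2"]
  by (simp add: norm_scaleC power_mult_distrib)

lemma square_summable_coord: "(\<lambda>i. (norm (coord f i))\<^sup>2) summable_on UNIV"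
  using coord[of f] by simp

lemma infsum_cinner_self:
  assumes "(\<lambda>i. (norm (f i :: 'a::complex_inner))\<^sup>2) summable_on UNIV"
  shows "(\<Sum>\<^sub>\<infinity>i. cinner (f i) (f i)) = complex_of_real (\<Sum>\<^sub>\<infinity>i. (norm (f i))\<^sup>2)"
  unfolding cinner_self using has_sum_of_real[OF has_sum_infsum[OF assms]] by (rule infsumI)

instantiation ell2 :: (type, chilbert_space) ab_group_add
begin
lift_definition zero_ell2 :: "('a, 'b) ell2" is "\<lambda>_. 0" by simp
lift_definition plus_ell2 :: "('a, 'b) ell2 \<Rightarrow> ('a, 'b) ell2 \<Rightarrow> ('a, 'b) ell2"
  is "\<lambda>f g i. f i + g i" by (rule square_summable_add)
lift_definition uminus_ell2 :: "('a, 'b) ell2 \<Rightarrow> ('a, 'b) ell2" is "\<lambda>f i. - f i" by simp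
lift_definition minus_ell2 :: "('a, 'b) ell2 \<Rightarrow> ('a, 'b) ell2 \<Rightarrow> ('a, 'b) ell2"
  is "\<lambda>f g i. f i - g i"
proof -
  fix f g :: "'a \<Rightarrow> 'b"
  assume "(\<lambda>i. (norm (f i))\<^sup>2) summable_on UNIV" "(\<lambda>i. (norm (g i))\<^sup>2) summable_on UNIV"
  then show "(\<lambda>i. (norm (f i - g i))\<^sup>2) summable_on UNIV"
    using square_summable_add[of f "\<lambda>i. - g i"] by simp
qed
instance
  by standard (transfer; simp add: fun_eq_iff algebra_simps)+
end

lemma square_summable_cinner:
  fixes f g :: "'i \<Rightarrow> 'a::complex_inner"
  assumes "(\<lambda>i. (norm (f i))\<^sup>2) summable_on UNIV" "(\<lambda>i. (norm (g i))\<^sup>2) summable_on UNIV"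
  shows "(\<lambda>i. cinner (f i) (g i)) summable_on UNIV"
proof (rule abs_summable_summable, rule summable_on_comparison_test)
  show "(\<lambda>i. (norm (f i))\<^sup>2 + (norm (g i))\<^sup>2) summable_on UNIV"
    by (intro summable_on_add assms)
  show "norm (cinner (f i) (g i)) \<le> (norm (f i))\<^sup>2 + (norm (g i))\<^sup>2" for i
    using cinner_Cauchy_Schwarz[of "f i" "g i"] sum_squares_bound[of "norm (f i)" "norm (g i)"]
      mult_nonneg_nonneg[OF norm_ge_zero[of "f i"] norm_ge_zero[of "g i"]] by linarith
qed simp

instantiation ell2 :: (type, chilbert_space) real_vector
begin
lift_definition scaleR_ell2 :: "real \<Rightarrow> ('a, 'b) ell2 \<Rightarrow> ('a, 'b) ell2"
  is "\<lambda>r f i. r *\<^sub>R f i"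
  by (simp add: power_mult_distrib summable_on_cmult_right)
instance
  by standard (transfer; simp add: fun_eq_iff scaleR_add_left scaleR_add_right)+
end

instantiation ell2 :: (type, chilbert_space) complex_inner
begin
lift_definition scaleC_ell2 :: "complex \<Rightarrow> ('a, 'b) ell2 \<Rightarrow> ('a, 'b) ell2"
  is "\<lambda>c f i. c *\<^sub>C f i" by (rule square_summable_scale)
lift_definition cinner_ell2 :: "('a, 'b) ell2 \<Rightarrow> ('a, 'b) ell2 \<Rightarrow> complex"
  is "\<lambda>f g. \<Sum>\<^sub>\<infinity>i. cinner (f i) (g i)" .
definition "inner_ell2 (f::('a, 'b) ell2) g = Re (cinner f g)"
definition "norm_ell2 (f::('a, 'b) ell2) = sqrt (inner f f)"
definition "sgn_ell2 (f::('a, 'b) ell2) = f /\<^sub>R norm f"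
definition "dist_ell2 (f::('a, 'b) ell2) g = norm (f - g)"
definition "uniformity_ell2 =
  (INF e\<in>{0<..}. principal {(f::('a, 'b) ell2, g). dist f g < e})"
definition "open_ell2 (U::('a, 'b) ell2 set) =
  (\<forall>f\<in>U. \<forall>\<^sub>F (f', g) in uniformity. f' = f \<longrightarrow> g \<in> U)"
instance
proof
  fix f g h :: "('a, 'b) ell2" and c d :: complex and r s :: real
  show cadd: "cinner (f + g) h = cinner f h + cinner g h" for f g h :: "('a, 'b) ell2"
    by transfer (simp add: cinner_add_left infsum_add square_summable_cinner)
  show cscale: "cinner (c *\<^sub>C f) g = c * cinner f g" for c and f g :: "('a, 'b) ell2"
    by transfer (simp add: cinner_scaleC_left infsum_cmult_right square_summable_cinner)
  show ccomm: "cinner f g = cnj (cinner g f)" for f g :: "('a, 'b) ell2"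
    by transfer (simp add: infsum_cnj[symmetric] cinner_commute[symmetric] del: infsum_cnj)
  have cself: "cinner f f = complex_of_real (\<Sum>\<^sub>\<infinity>i. (norm (coord f i))\<^sup>2)"
    for f :: "('a, 'b) ell2"
    by (simp only: cinner_ell2.rep_eq infsum_cinner_self[OF square_summable_coord])
  show "c *\<^sub>C (f + g) = c *\<^sub>C f + c *\<^sub>C g"
    by transfer (simp add: scaleC_add_right)
  show addl: "(c + d) *\<^sub>C f = c *\<^sub>C f + d *\<^sub>C f" for c d
    by transfer (simp add: scaleC_add_left)
  show "c *\<^sub>C d *\<^sub>C f = (c * d) *\<^sub>C f"
    by transfer (simp add: scaleC_scaleC)
  show rr: "complex_of_real r *\<^sub>C f = r *\<^sub>R f"
    by transfer (simp add: scaleC_of_real)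
  show "Re (cinner f g) = inner f g"
    by (simp add: inner_ell2_def)
  show "inner f g = inner g f"
    unfolding inner_ell2_def using ccomm[of f g] by simp
  show "inner (f + g) h = inner f h + inner g h"
    unfolding inner_ell2_def by (simp add: cadd)
  show "inner (r *\<^sub>R f) g = r * inner f g"
    unfolding inner_ell2_def rr[symmetric] by (simp add: cscale)
  show "0 \<le> inner f f"
    unfolding inner_ell2_def cself by (simp add: infsum_nonneg)
  show "inner f f = 0 \<longleftrightarrow> f = 0"
  proof
    assume "inner f f = 0"
    then have 0: "(\<Sum>\<^sub>\<infinity>i. (norm (coord f i))\<^sup>2) = 0"
      unfolding inner_ell2_def cself by simp
    have "(norm (coord f i))\<^sup>2 = 0" for i
      by (rule nonneg_infsum_le_0D[OF _ ]) (use 0 coord[of f] in auto)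
    then show "f = 0" by transfer auto
  next
    assume "f = 0"
    then show "inner f f = 0"
      unfolding inner_ell2_def by (simp, transfer) (simp add: cinner_zero_left)
  qed
qed (rule norm_ell2_def sgn_ell2_def dist_ell2_def uniformity_ell2_def open_ell2_def)+
end

lemma ell2_norm_square: "(norm f)\<^sup>2 = (\<Sum>\<^sub>\<infinity>i. (norm (coord f i))\<^sup>2)"
proof -
  have "complex_of_real ((norm f)\<^sup>2) = complex_of_real (\<Sum>\<^sub>\<infinity>i. (norm (coord f i))\<^sup>2)"
    unfolding cinner_self[symmetric]
    by (simp only: cinner_ell2.rep_eq infsum_cinner_self[OF square_summable_coord])
  then show ?thesis by (simp only: of_real_eq_iff)
qed

lemma ell2_finite_le_norm:
  assumes "finite I" shows "(\<Sum>i\<in>I. (norm (coord f i))\<^sup>2) \<le> (norm f)\<^sup>2"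
  unfolding ell2_norm_square
  by (rule finite_sum_le_infsum) (use coord[of f] assms in auto)

lemma norm_coord_le: "norm (coord f i) \<le> norm f"
  using ell2_finite_le_norm[of "{i}" f] by (simp add: power2_le_iff_abs_le)

instance ell2 :: (type, chilbert_space) chilbert_space
proof
  fix X :: "nat \<Rightarrow> ('a, 'b) ell2"
  assume X: "Cauchy X"
  have "Cauchy (\<lambda>n. coord (X n) i)" for i
  proof (rule metric_CauchyI)
    fix e :: real assume "0 < e"
    from metric_CauchyD[OF X this]
    obtain N where N: "\<forall>m\<ge>N. \<forall>n\<ge>N. dist (X m) (X n) < e" by blast
    have "dist (coord (X m) i) (coord (X n) i) < e" if "N \<le> m" "N \<le> n" for m n
      using N that norm_coord_le[of "X m - X n" i]
      by (auto simp: dist_norm minus_ell2.rep_eq intro: le_less_trans)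
    then show "\<exists>N. \<forall>m\<ge>N. \<forall>n\<ge>N. dist (coord (X m) i) (coord (X n) i) < e" by blast
  qed
  then obtain g where g: "\<And>i. (\<lambda>n. coord (X n) i) \<longlonglongrightarrow> g i"
    unfolding Cauchy_convergent_iff convergent_def by metis
  have tail: "\<exists>N. \<forall>n\<ge>N. \<forall>I. finite I \<longrightarrow> (\<Sum>i\<in>I. (norm (coord (X n) i - g i))\<^sup>2) \<le> e\<^sup>2"
    if "0 < e" for e :: real
  proof -
    from metric_CauchyD[OF X that]
    obtain N where N: "\<forall>m\<ge>N. \<forall>n\<ge>N. dist (X m) (X n) < e" by blast
    have "(\<Sum>i\<in>I. (norm (coord (X n) i - g i))\<^sup>2) \<le> e\<^sup>2" if n: "N \<le> n" and I: "finite I" for n I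
    proof (rule LIMSEQ_le_const2)
      show "(\<lambda>m. \<Sum>i\<in>I. (norm (coord (X n) i - coord (X m) i))\<^sup>2)
          \<longlonglongrightarrow> (\<Sum>i\<in>I. (norm (coord (X n) i - g i))\<^sup>2)"
        by (intro tendsto_intros g)
      have "(\<Sum>i\<in>I. (norm (coord (X n) i - coord (X m) i))\<^sup>2) \<le> e\<^sup>2" if "N \<le> m" for m
      proof -
        have "(norm (X n - X m))\<^sup>2 \<le> e\<^sup>2"
          using N n that by (intro power_mono) (auto simp: dist_norm less_imp_le)
        then show ?thesis
          using ell2_finite_le_norm[OF I, of "X n - X m"] by (simp add: minus_ell2.rep_eq)
      qed
      then show "\<exists>N. \<forall>m\<ge>N. (\<Sum>i\<in>I. (norm (coord (X n) i - coord (X m) i))\<^sup>2) \<le> e\<^sup>2"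
        by blast
    qed
    then show ?thesis by blast
  qed
  have diff: "(\<lambda>i. (norm (coord (X n) i - g i))\<^sup>2) summable_on UNIV"
    if "\<forall>I. finite I \<longrightarrow> (\<Sum>i\<in>I. (norm (coord (X n) i - g i))\<^sup>2) \<le> e" for n and e :: real
    by (rule nonneg_bdd_above_summable_on) (use that in \<open>auto simp: bdd_above_def\<close>)
  obtain N where N: "\<forall>n\<ge>N. \<forall>I. finite I \<longrightarrow> (\<Sum>i\<in>I. (norm (coord (X n) i - g i))\<^sup>2) \<le> 1\<^sup>2"
    using tail[of 1] by auto
  have "(\<lambda>i. (norm (g i - coord (X N) i))\<^sup>2) summable_on UNIV"
    using diff[of N "1\<^sup>2"] N by (simp add: norm_minus_commute)
  from square_summable_add[OF this, of "coord (X N)"] coord[of "X N"]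
  have gs: "(\<lambda>i. (norm (g i))\<^sup>2) summable_on UNIV" by simp
  define L where "L = (Abs_ell2 g :: ('a, 'b) ell2)"
  have L: "coord L = g" unfolding L_def using gs by (simp add: Abs_ell2_inverse)
  have "X \<longlonglongrightarrow> L"
  proof (rule metric_LIMSEQ_I)
    fix e :: real assume e: "0 < e"
    obtain N where N: "\<forall>n\<ge>N. \<forall>I. finite I \<longrightarrow> (\<Sum>i\<in>I. (norm (coord (X n) i - g i))\<^sup>2) \<le> (e/2)\<^sup>2"
      using tail[of "e/2"] e by auto
    have "dist (X n) L < e" if "N \<le> n" for n
    proof -
      have "(norm (X n - L))\<^sup>2 \<le> (e/2)\<^sup>2"
        unfolding ell2_norm_square
        by (rule infsum_le_finite_sums)
          (use diff[of n "(e/2)\<^sup>2"] N that L in \<open>auto simp: minus_ell2.rep_eq\<close>)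
      then have "norm (X n - L) \<le> e/2"
        by (rule power2_le_imp_le) (use e in simp)
      then show ?thesis using e by (simp add: dist_norm)
    qed
    then show "\<exists>N. \<forall>n\<ge>N. dist (X n) L < e" by blast
  qed
  then show "convergent X" by (auto simp: convergent_def)
qed

lift_definition ell2_basis :: "'i \<Rightarrow> ('i, complex) ell2" is "\<lambda>i j. if j = i then 1 else 0"
proof -
  fix i :: 'i
  show "(\<lambda>j. (norm (if j = i then 1 else 0 :: complex))\<^sup>2) summable_on UNIV"
    by (rule finite_nonzero_values_imp_summable_on) (simp add: if_distrib)
qed

text \<open>
  A word over the finite generator type \<open>'n\<close> is an element of the free semigroup on
  \<open>CARD('n)\<close> generators, with \<open>[]\<close> as identity. The words of length \<open>m\<close> index the orthonormal
  basis \<open>e\<^sub>i\<^sub>1 \<otimes> \<dots> \<otimes> e\<^sub>i\<^sub>m\<close> of the \<open>m\<close>-th tensor power of \<open>H\<^sub>n\<close>, so the Hilbert sum of all tensor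
  powers is the space of square summable scalar families on words; \<open>coord \<xi> w\<close> is the
  coefficient of \<open>\<xi>\<close> at the basis vector belonging to \<open>w\<close>.
\<close>

type_synonym 'n fock = "('n list, complex) ell2"

text \<open>The map \<open>\<xi> \<mapsto> e\<^sub>i \<otimes> \<xi>\<close> in coordinates.\<close>

lift_definition creation_fun :: "'n \<Rightarrow> 'n fock \<Rightarrow> 'n fock"
  is "\<lambda>i f w. case w of [] \<Rightarrow> 0 | j # v \<Rightarrow> if j = i then f v else 0"
proof -
  fix i :: 'n and f :: "'n list \<Rightarrow> complex"
  assume f: "(\<lambda>v. (norm (f v))\<^sup>2) summable_on UNIV"
  let ?g = "\<lambda>w. case w of [] \<Rightarrow> 0 | j # v \<Rightarrow> if j = i then f v else 0"
  have "(\<lambda>w. (norm (?g w))\<^sup>2) summable_on range (Cons i)"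
    by (subst summable_on_reindex) (use f in \<open>simp_all add: inj_on_def o_def\<close>)
  then show "(\<lambda>w. (norm (?g w))\<^sup>2) summable_on UNIV"
    by (rule summable_on_cong_neutral[THEN iffD1, rotated -1])
      (auto split: list.splits)
qed

lemma norm_creation_fun: "norm (creation_fun i f) = norm f"
proof -
  have "(norm (creation_fun i f))\<^sup>2
      = (\<Sum>\<^sub>\<infinity>w\<in>range (Cons i). (norm (coord (creation_fun i f) w))\<^sup>2)"
    unfolding ell2_norm_square
    by (rule infsum_cong_neutral) (auto simp: creation_fun.rep_eq split: list.splits)
  also have "\<dots> = (norm f)\<^sup>2"
    unfolding ell2_norm_square
    by (subst infsum_reindex) (simp_all add: inj_on_def o_def creation_fun.rep_eq)
  finally show ?thesis by simp
qed

lift_definition creation :: "'n \<Rightarrow> 'n fock \<Rightarrow>\<^sub>L 'n fock" is creation_fun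
proof (rule bounded_linear_intro)
  fix i :: 'n and f g :: "'n fock" and r :: real
  show "creation_fun i (f + g) = creation_fun i f + creation_fun i g"
    by transfer (auto simp: fun_eq_iff split: list.splits)
  show "creation_fun i (r *\<^sub>R f) = r *\<^sub>R creation_fun i f"
    by transfer (auto simp: fun_eq_iff split: list.splits)
  show "norm (creation_fun i f) \<le> norm f * 1"
    by (simp add: norm_creation_fun)
qed

lemma creation_basis: "blinfun_apply (creation i) (ell2_basis w) = ell2_basis (i # w)"
  by (simp add: creation.rep_eq coord_inject[symmetric] creation_fun.rep_eq ell2_basis.rep_eq
      fun_eq_iff split: list.splits)

section \<open>Operators and Hilbert space tensor products\<close>

text \<open>
  The library type \<open>'a \<Rightarrow>\<^sub>L 'b\<close> consists of the real-linear bounded maps; the predicate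
  \<open>clinear_op\<close> singles out the complex-linear ones. The operator norm is the same in both settings.
\<close>

definition clinear_op :: "('a::complex_inner \<Rightarrow>\<^sub>L 'b::complex_inner) \<Rightarrow> bool" where
  "clinear_op T \<longleftrightarrow> (\<forall>c x. blinfun_apply T (c *\<^sub>C x) = c *\<^sub>C blinfun_apply T x)"

definition cadjoint :: "('a::chilbert_space \<Rightarrow>\<^sub>L 'b::chilbert_space) \<Rightarrow> 'b \<Rightarrow>\<^sub>L 'a" where
  "cadjoint T = (THE T'. \<forall>x y. cinner (blinfun_apply T x) y = cinner x (blinfun_apply T' y))"

lemma riesz_representation:
  fixes \<phi> :: "'a::{real_inner, complete_space} \<Rightarrow> real"
  assumes "bounded_linear \<phi>"
  obtains z where "\<And>x. \<phi> x = inner x z"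
proof -
  interpret bounded_linear \<phi> by fact
  obtain K where K: "\<And>x. norm (\<phi> x) \<le> norm x * K" using bounded by blast
  define J where "J x = (norm x)\<^sup>2 - 2 * \<phi> x" for x
  have J_lower: "- K\<^sup>2 \<le> J x" for x
  proof -
    have "2 * \<phi> x \<le> 2 * (norm x * K)" using K[of x] by simp
    also have "\<dots> \<le> (norm x)\<^sup>2 + K\<^sup>2" using sum_squares_bound[of "norm x" K] by simp
    finally show ?thesis by (simp add: J_def)
  qed
  define m where "m = (INF x. J x)"
  have bdd: "bdd_below (range J)" using J_lower by (auto simp: bdd_below_def)
  have m_le: "m \<le> J x" for x unfolding m_def by (rule cINF_lower[OF bdd]) simp
  have "\<exists>x. J x < m + 1 / real (Suc n)" for n
  proof -
    have "m < m + 1 / real (Suc n)" by simp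
    then show ?thesis unfolding m_def using cINF_less_iff[OF _ bdd] by blast
  qed
  then obtain X where X: "\<And>n. J (X n) < m + 1 / real (Suc n)" by metis
  have par: "(norm (x - y))\<^sup>2 \<le> 2 * (J x - m) + 2 * (J y - m)" for x y
  proof -
    define p where "p = (1/2) *\<^sub>R (x + y)"
    have "(norm (x - y))\<^sup>2 = 2 * J x + 2 * J y - 4 * J p"
      unfolding J_def p_def power2_norm_eq_inner
      by (simp add: inner_diff_left inner_diff_right inner_add_left inner_add_right
          inner_commute add scaleR scale algebra_simps)
    then show ?thesis using m_le[of p] by (simp add: algebra_simps)
  qed
  have "Cauchy X"
  proof (rule metric_CauchyI)
    fix e :: real assume e: "0 < e"
    then obtain N where N: "inverse (real (Suc N)) < e\<^sup>2 / 4"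
      using reals_Archimedean[of "e\<^sup>2 / 4"] by auto
    have small: "J (X n) - m < e\<^sup>2 / 4" if "N \<le> n" for n
    proof -
      have "1 / real (Suc n) \<le> inverse (real (Suc N))"
        using that by (simp add: field_simps)
      then show ?thesis using X[of n] N by linarith
    qed
    have "dist (X i) (X j) < e" if "N \<le> i" "N \<le> j" for i j
    proof -
      have "(norm (X i - X j))\<^sup>2 < e\<^sup>2"
        using par[of "X i" "X j"] small[OF that(1)] small[OF that(2)] by argo
      then show ?thesis unfolding dist_norm by (rule power2_less_imp_less) (use e in simp)
    qed
    then show "\<exists>N. \<forall>i\<ge>N. \<forall>j\<ge>N. dist (X i) (X j) < e" by blast
  qed
  then obtain z where z: "X \<longlonglongrightarrow> z" by (auto simp: Cauchy_convergent_iff convergent_def)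
  have "(\<lambda>n. J (X n)) \<longlonglongrightarrow> J z"
    unfolding J_def by (intro tendsto_intros z tendsto)
  moreover have "(\<lambda>n. m + 1 / real (Suc n)) \<longlonglongrightarrow> m + 0"
    by (intro tendsto_intros LIMSEQ_Suc[OF lim_1_over_n])
  ultimately have "J z \<le> m + 0"
    by (rule LIMSEQ_le) (use X in \<open>auto intro: less_imp_le\<close>)
  then have min: "J z \<le> J x" for x using m_le[of x] by simp
  have "\<phi> x = inner x z" for x
  proof -
    define d where "d = inner x z - \<phi> x"
    define s where "s = inner x x"
    have s: "0 \<le> s" by (simp add: s_def)
    have "J (z + t *\<^sub>R x) = J z + 2 * t * d + t\<^sup>2 * s" for t
      unfolding J_def d_def s_def power2_norm_eq_inner
      by (simp add: inner_add_left inner_add_right inner_commute add scaleR scale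
          algebra_simps power2_eq_square)
    then have quad: "0 \<le> 2 * t * d + t\<^sup>2 * s" for t using min[of "z + t *\<^sub>R x"] by simp
    have "0 \<le> 2 * (- d / (s + 1)) * d + (- d / (s + 1))\<^sup>2 * s" by (rule quad)
    also have "\<dots> = - (d\<^sup>2 * (s + 2)) / (s + 1)\<^sup>2"
      using s by (simp add: divide_simps power2_eq_square) (simp add: algebra_simps)
    finally have "d\<^sup>2 * (s + 2) / (s + 1)\<^sup>2 \<le> 0" by simp
    then have "d = 0" using s
      by (smt (verit) divide_pos_pos mult_pos_pos zero_less_power2)
    then show ?thesis by (simp add: d_def)
  qed
  then show ?thesis by (rule that)
qed

lemma cinner_eqI:
  assumes "\<And>x. cinner x y = cinner x (z::'a::complex_inner)" shows "y = z"
  by (metis Re_cinner assms inner_eq_zero_iff inner_diff_right right_minus_eq)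

lemma cadjoint_eqI:
  assumes "\<And>x y. cinner (blinfun_apply T x) y = cinner x (blinfun_apply T' y)"
  shows "cadjoint T = T'"
  unfolding cadjoint_def
proof (rule the_equality)
  fix S assume S: "\<forall>x y. cinner (blinfun_apply T x) y = cinner x (blinfun_apply S y)"
  show "S = T'"
    by (rule blinfun_eqI, rule cinner_eqI) (metis S assms)
qed (use assms in blast)

lemma cadjoint:
  fixes T :: "'a::chilbert_space \<Rightarrow>\<^sub>L 'b::chilbert_space"
  assumes "clinear_op T"
  shows "cinner (blinfun_apply T x) y = cinner x (blinfun_apply (cadjoint T) y)"
proof -
  have "\<exists>z. \<forall>x. inner (blinfun_apply T x) y = inner x z" for y
  proof -
    have "bounded_linear (\<lambda>x. inner (blinfun_apply T x) y)"
      by (intro bounded_linear_inner_left_comp blinfun.bounded_linear_right)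
    then obtain z where "\<And>x. inner (blinfun_apply T x) y = inner x z"
      by (rule riesz_representation) blast
    then show ?thesis by blast
  qed
  then obtain S where S: "\<And>x y. inner (blinfun_apply T x) y = inner x (S y)" by metis
  have "bounded_linear S"
  proof (rule bounded_linear_intro)
    show "S (y + z) = S y + S z" for y z
      by (rule vector_eq_rdot[THEN iffD1])
        (simp add: inner_add_left inner_add_right inner_commute S[symmetric])
    show "S (r *\<^sub>R y) = r *\<^sub>R S y" for r y
      by (rule vector_eq_rdot[THEN iffD1]) (simp add: S[symmetric] inner_commute)
    show "norm (S y) \<le> norm y * norm T" for y
    proof (cases "S y = 0")
      case False
      have "norm (S y) * norm (S y) = inner (blinfun_apply T (S y)) y"
        by (simp add: S power2_norm_eq_inner[symmetric] power2_eq_square)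
      also have "\<dots> \<le> norm (blinfun_apply T (S y)) * norm y" by (rule norm_cauchy_schwarz)
      also have "\<dots> \<le> norm T * norm (S y) * norm y"
        by (intro mult_right_mono norm_blinfun) simp
      finally show ?thesis using False by (simp add: mult.commute mult.left_commute)
    qed simp
  qed
  then have S': "blinfun_apply (Blinfun S) = S" by (rule bounded_linear_Blinfun_apply)
  have "cinner (blinfun_apply T x) y = cinner x (blinfun_apply (Blinfun S) y)" for x y
  proof (rule complex_eqI)
    show "Re (cinner (blinfun_apply T x) y) = Re (cinner x (blinfun_apply (Blinfun S) y))"
      by (simp add: Re_cinner S S')
    have Im: "Im (cinner u v) = inner ((- \<i>) *\<^sub>C u) v" for u v :: "'c::complex_inner"
      unfolding Re_cinner[symmetric] cinner_scaleC_left by simp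
    show "Im (cinner (blinfun_apply T x) y) = Im (cinner x (blinfun_apply (Blinfun S) y))"
      using assms unfolding Im S' S[symmetric] clinear_op_def by metis
  qed
  then show ?thesis using cadjoint_eqI by metis
qed

text \<open>
  \<open>hilbert_tensor t\<close>: the codomain of \<open>t\<close>, with \<open>t x y\<close> as the elementary tensor of \<open>x\<close> and \<open>y\<close>, is
  the Hilbert space tensor product of the two argument spaces. This determines it up to a unitary
  map preserving elementary tensors. The real span in the density condition is already a complex
  subspace, since complex scalars can be absorbed into an elementary tensor.
\<close>

definition hilbert_tensor ::
    "('a::chilbert_space \<Rightarrow> 'b::chilbert_space \<Rightarrow> 'c::chilbert_space) \<Rightarrow> bool" where
  "hilbert_tensor t \<longleftrightarrow>
     (\<forall>x x' y. t (x + x') y = t x y + t x' y) \<and>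
     (\<forall>x y y'. t x (y + y') = t x y + t x y') \<and>
     (\<forall>c x y. t (c *\<^sub>C x) y = c *\<^sub>C t x y) \<and>
     (\<forall>c x y. t x (c *\<^sub>C y) = c *\<^sub>C t x y) \<and>
     (\<forall>x x' y y'. cinner (t x y) (t x' y') = cinner x x' * cinner y y') \<and>
     closure (span {t x y | x y. True}) = UNIV"

text \<open>
  For a space of square summable scalar families (such as the Fock space), a concrete tensor product
  is the corresponding space of vector-valued families.
\<close>

lift_definition ell2_tensor ::
    "'a::chilbert_space \<Rightarrow> ('i, complex) ell2 \<Rightarrow> ('i, 'a) ell2" is "\<lambda>x f i. f i *\<^sub>C x"
  by (simp add: norm_scaleC power_mult_distrib summable_on_cmult_left)

lemma coord_sum: "coord (\<Sum>i\<in>I. f i) j = (\<Sum>i\<in>I. coord (f i) j)"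
  by (induction I rule: infinite_finite_induct) (simp_all add: zero_ell2.rep_eq plus_ell2.rep_eq)

lemma hilbert_tensor_ell2:
  "hilbert_tensor (ell2_tensor :: 'a::chilbert_space \<Rightarrow> ('i, complex) ell2 \<Rightarrow> ('i, 'a) ell2)"
  unfolding hilbert_tensor_def
proof (intro conjI allI)
  fix x x' :: 'a and f g :: "('i, complex) ell2" and c :: complex
  show "ell2_tensor (x + x') f = ell2_tensor x f + ell2_tensor x' f"
    by transfer (simp add: scaleC_add_right)
  show "ell2_tensor x (f + g) = ell2_tensor x f + ell2_tensor x g"
    by transfer (simp add: scaleC_add_left)
  show "ell2_tensor (c *\<^sub>C x) f = c *\<^sub>C ell2_tensor x f"
    by transfer (simp add: scaleC_scaleC mult.commute)
  show "ell2_tensor x (c *\<^sub>C f) = c *\<^sub>C ell2_tensor x f"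
    by transfer (simp add: scaleC_scaleC scaleC_complex_def)
  have "(\<lambda>i. cinner (coord f i) (coord g i)) summable_on UNIV"
    by (intro square_summable_cinner square_summable_coord)
  from infsum_cmult_right[OF this, of "cinner x x'"]
  show "cinner (ell2_tensor x f) (ell2_tensor x' g) = cinner x x' * cinner f g"
    by (simp add: cinner_ell2.rep_eq ell2_tensor.rep_eq cinner_scaleC_left cinner_scaleC_right
        cinner_complex_def mult_ac)
next
  let ?S = "{ell2_tensor x f | (x::'a) (f::('i, complex) ell2). True}"
  have "g \<in> closure (span ?S)" for g :: "('i, 'a) ell2"
    unfolding closure_approachable
  proof (intro allI impI)
    fix e :: real assume e: "0 < e"
    obtain I where I: "finite I"
        "dist (\<Sum>i\<in>I. (norm (coord g i))\<^sup>2) (\<Sum>\<^sub>\<infinity>i. (norm (coord g i))\<^sup>2) \<le> e\<^sup>2 / 2"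
      using infsum_finite_approximation[OF square_summable_coord[of g], of "e\<^sup>2 / 2"] e by auto
    define h where "h = (\<Sum>i\<in>I. ell2_tensor (coord g i) (ell2_basis i))"
    have h: "coord h j = (if j \<in> I then coord g j else 0)" for j
    proof -
      have "coord h j = (\<Sum>i\<in>I. if j = i then coord g i else 0)"
        unfolding h_def coord_sum
        by (rule sum.cong)
          (simp_all add: ell2_tensor.rep_eq ell2_basis.rep_eq scaleC_one
            scaleC_of_real[of 0, simplified])
      then show ?thesis using I(1) by simp
    qed
    have "(norm (h - g))\<^sup>2 = (\<Sum>\<^sub>\<infinity>i\<in>UNIV - I. (norm (coord g i))\<^sup>2)"
      unfolding ell2_norm_square by (rule infsum_cong_neutral) (auto simp: minus_ell2.rep_eq h)
    also have "\<dots> = (\<Sum>\<^sub>\<infinity>i. (norm (coord g i))\<^sup>2) - (\<Sum>i\<in>I. (norm (coord g i))\<^sup>2)"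
      using I(1) square_summable_coord[of g] by (subst infsum_Diff) simp_all
    also have "\<dots> \<le> e\<^sup>2 / 2" using I(2) unfolding dist_real_def by linarith
    also have "\<dots> < e\<^sup>2" using e by simp
    finally have "norm (h - g) < e" by (rule power2_less_imp_less) (use e in simp)
    moreover have "h \<in> span ?S"
      unfolding h_def by (intro span_sum span_base) blast
    ultimately show "\<exists>h\<in>span ?S. dist h g < e" unfolding dist_norm by blast
  qed
  then show "closure (span ?S) = UNIV" by blast
qed

text \<open>
  The operator \<open>A \<otimes> X\<close>. It exists when \<open>A\<close> and \<open>X\<close> are complex-linear, and it is unique because
  elementary tensors have dense span.
\<close>

definition tensor_op ::
    "('a::chilbert_space \<Rightarrow> 'b::chilbert_space \<Rightarrow> 'c::chilbert_space) \<Rightarrow>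
     ('a \<Rightarrow>\<^sub>L 'a) \<Rightarrow> ('b \<Rightarrow>\<^sub>L 'b) \<Rightarrow> 'c \<Rightarrow>\<^sub>L 'c" where
  "tensor_op t A X =
     (THE T. \<forall>x y. blinfun_apply T (t x y) = t (blinfun_apply A x) (blinfun_apply X y))"

section \<open>Free holomorphic functions\<close>

primrec word_op :: "('n \<Rightarrow> 'h::complex_inner \<Rightarrow>\<^sub>L 'h) \<Rightarrow> 'n list \<Rightarrow> 'h \<Rightarrow>\<^sub>L 'h" where
  "word_op X [] = id_blinfun"
| "word_op X (i # w) = X i o\<^sub>L word_op X w"

definition op_ball :: "real \<Rightarrow> ('n::finite \<Rightarrow> 'h::chilbert_space \<Rightarrow>\<^sub>L 'h) set" where
  "op_ball \<gamma> = {X. (\<forall>i. clinear_op (X i)) \<and> sqrt (norm (\<Sum>i\<in>UNIV. X i o\<^sub>L cadjoint (X i))) < \<gamma>}"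

definition coeff_square_sum ::
    "('n::finite list \<Rightarrow> 'k::chilbert_space \<Rightarrow>\<^sub>L 'k) \<Rightarrow> nat \<Rightarrow> 'k \<Rightarrow>\<^sub>L 'k" where
  "coeff_square_sum A k = (\<Sum>w | length w = k. cadjoint (A w) o\<^sub>L A w)"

definition free_series ::
    "('k::chilbert_space \<Rightarrow> 'h::chilbert_space \<Rightarrow> 'kh::chilbert_space) \<Rightarrow>
     ('n::finite list \<Rightarrow> 'k \<Rightarrow>\<^sub>L 'k) \<Rightarrow> ('n \<Rightarrow> 'h \<Rightarrow>\<^sub>L 'h) \<Rightarrow> 'kh \<Rightarrow>\<^sub>L 'kh" where
  "free_series t A X = (\<Sum>k. \<Sum>w | length w = k. tensor_op t (A w) (word_op X w))"

text \<open>
  \<open>F\<close> is the free holomorphic function on the ball of radius \<open>\<gamma>\<close> with coefficients \<open>A\<close>. The term of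
  the limes superior at \<open>k = 0\<close> has exponent \<open>1 / 0 = 0\<close> and does not affect it.
\<close>

definition free_holomorphic ::
    "('k::chilbert_space \<Rightarrow> 'h::chilbert_space \<Rightarrow> 'kh::chilbert_space) \<Rightarrow> real \<Rightarrow>
     ('n::finite list \<Rightarrow> 'k \<Rightarrow>\<^sub>L 'k) \<Rightarrow> (('n \<Rightarrow> 'h \<Rightarrow>\<^sub>L 'h) \<Rightarrow> 'kh \<Rightarrow>\<^sub>L 'kh) \<Rightarrow> bool" where
  "free_holomorphic t \<gamma> A F \<longleftrightarrow>
     (\<forall>w. clinear_op (A w)) \<and>
     limsup (\<lambda>k. ereal (norm (coeff_square_sum A k) powr (1 / (2 * real k)))) \<le> ereal (1 / \<gamma>) \<and>
     (\<forall>X\<in>op_ball \<gamma>. F X = free_series t A X)"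

end

theory Submission
  imports Defs
begin

text \<open>
  Applied to \<open>x \<otimes> 1\<close>, where \<open>1\<close> is the vacuum vector, the operator \<open>F(\<rho>S)\<close> gives
  \<open>\<Sum>\<^sub>w \<rho>\<^bsup>|w|\<^esup> A\<^sub>w x \<otimes> e\<^sub>w\<close>, so by orthonormality of the \<open>e\<^sub>w\<close> the part of degree \<open>k\<close> satisfies
  \<open>\<rho>\<^bsup>2k\<^esup> \<Sum>\<^bsub>|w| = k\<^esub> \<parallel>A\<^sub>w x\<parallel>\<^sup>2 \<le> M(\<rho>)\<^sup>2 \<parallel>x\<parallel>\<^sup>2\<close>, and the left-hand side bounds
  the positive operator \<open>\<Sum> A\<^sub>w\<^sup>* A\<^sub>w\<close>. The series for \<open>F(\<rho>S)\<close> converges because the isometries \<open>S\<^sub>w\<close>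
  with \<open>|w| = k\<close> have orthogonal ranges, which gives
  \<open>\<parallel>\<Sum>\<^bsub>|w| = k\<^esub> A\<^sub>w \<otimes> S\<^sub>w\<parallel> \<le> \<parallel>\<Sum> A\<^sub>w\<^sup>* A\<^sub>w\<parallel>\<^bsup>1/2\<^esup>\<close>. An arbitrary Hilbert space tensor product with the
  Fock space is moved to the space of square summable families by the coordinate isometry
  \<open>V\<close>, whose coordinate at \<open>w\<close> is the adjoint of \<open>x \<mapsto> x \<otimes> e\<^sub>w\<close>; since \<open>V\<^sup>* V = 1\<close>, conjugation
  with \<open>V\<close> also shows that the operators \<open>A\<^sub>w \<otimes> S\<^sub>w\<close> exist.
\<close>

section \<open>Adjoints of isometries, and norms of sums of operators
  \<open>cadjoint T o\<^sub>L T\<close>\<close>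

lemma clinear_op_cadjoint:
  fixes T :: "'a::chilbert_space \<Rightarrow>\<^sub>L 'b::chilbert_space"
  assumes "clinear_op T"
  shows "clinear_op (cadjoint T)"
  unfolding clinear_op_def
  by (intro allI, rule cinner_eqI)
    (simp add: cadjoint[OF assms, symmetric] cinner_scaleC_right)

lemma isometry_inner:
  fixes V :: "'a::real_inner \<Rightarrow>\<^sub>L 'b::real_inner"
  assumes "\<And>x. norm (blinfun_apply V x) = norm x"
  shows "inner (blinfun_apply V x) (blinfun_apply V y) = inner x y"
  by (simp add: dot_norm assms flip: blinfun.add_right)

text \<open>The adjoint is a contractive left inverse of an isometry. For the norm bound,
  \<open>u = cadjoint V g\<close> satisfies \<open>norm u ^ 2 = inner (V u) g\<close>, and
  \<open>V u\<close> has the norm of \<open>u\<close>.\<close>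

lemma isometry_cadjoint:
  fixes V :: "'a::chilbert_space \<Rightarrow>\<^sub>L 'b::chilbert_space"
  assumes V: "clinear_op V" "\<And>x. norm (blinfun_apply V x) = norm x"
  shows "blinfun_apply (cadjoint V) (blinfun_apply V x) = x"
    and "norm (cadjoint V) \<le> 1"
proof -
  have adj: "inner (blinfun_apply V y) g = inner y (blinfun_apply (cadjoint V) g)" for y g
    using cadjoint[OF V(1)] by (metis Re_cinner)
  show "blinfun_apply (cadjoint V) (blinfun_apply V x) = x"
    by (rule vector_eq_ldot[THEN iffD1]) (simp add: adj[symmetric] isometry_inner[OF V(2)])
  have "norm (blinfun_apply (cadjoint V) g) \<le> 1 * norm g" for g
  proof (cases "blinfun_apply (cadjoint V) g = 0")
    case False
    let ?u = "blinfun_apply (cadjoint V) g"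
    have "norm ?u * norm ?u = inner (blinfun_apply V ?u) g"
      by (simp add: adj power2_norm_eq_inner[symmetric] power2_eq_square)
    also have "\<dots> \<le> norm ?u * norm g"
      using norm_cauchy_schwarz[of "blinfun_apply V ?u" g] by (simp add: V(2))
    finally show ?thesis using False by simp
  qed simp
  then show "norm (cadjoint V) \<le> 1" by (intro norm_blinfun_bound) auto
qed

lemma inner_sum_cadjoint_comp:
  fixes T :: "'i \<Rightarrow> 'a::chilbert_space \<Rightarrow>\<^sub>L 'b::chilbert_space"
  assumes "\<And>i. i \<in> I \<Longrightarrow> clinear_op (T i)"
  shows "inner x (blinfun_apply (\<Sum>i\<in>I. cadjoint (T i) o\<^sub>L T i) y)
    = (\<Sum>i\<in>I. inner (blinfun_apply (T i) x) (blinfun_apply (T i) y))"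
proof -
  have "inner x (blinfun_apply (cadjoint (T i) o\<^sub>L T i) y)
      = inner (blinfun_apply (T i) x) (blinfun_apply (T i) y)" if "i \<in> I" for i
    using cadjoint[OF assms[OF that]] by (simp add: Re_cinner[symmetric])
  then show ?thesis
    by (simp add: blinfun.sum_left inner_sum_right)
qed

text \<open>The left-hand side is the quadratic form of the operator on the right, so Cauchy-Schwarz
  suffices.\<close>

lemma sum_norm_square_le:
  fixes T :: "'i \<Rightarrow> 'a::chilbert_space \<Rightarrow>\<^sub>L 'b::chilbert_space"
  assumes "\<And>i. i \<in> I \<Longrightarrow> clinear_op (T i)"
  shows "(\<Sum>i\<in>I. (norm (blinfun_apply (T i) x))\<^sup>2)
    \<le> norm (\<Sum>i\<in>I. cadjoint (T i) o\<^sub>L T i) * (norm x)\<^sup>2"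
proof -
  let ?Q = "\<Sum>i\<in>I. cadjoint (T i) o\<^sub>L T i"
  have "(\<Sum>i\<in>I. (norm (blinfun_apply (T i) x))\<^sup>2) = inner x (blinfun_apply ?Q x)"
    by (subst inner_sum_cadjoint_comp) (simp_all add: assms power2_norm_eq_inner)
  also have "\<dots> \<le> norm x * norm (blinfun_apply ?Q x)" by (rule norm_cauchy_schwarz)
  also have "\<dots> \<le> norm x * (norm ?Q * norm x)" by (intro mult_left_mono norm_blinfun) simp
  finally show ?thesis by (simp add: power2_eq_square mult_ac)
qed

text \<open>A converse to \<open>sum_norm_square_le\<close>. The hypothesis says that the column
  operator with entries \<open>T i\<close> has norm at most \<open>c\<close>, and the sum is its
  adjoint times itself. Without forming the column, \<open>?Q y\<close> is tested against itself:
  Cauchy-Schwarz in each entry and then over \<open>I\<close> gives one factor \<open>c\<close> from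
  either side.\<close>

lemma norm_sum_cadjoint_comp_le:
  fixes T :: "'i \<Rightarrow> 'a::chilbert_space \<Rightarrow>\<^sub>L 'b::chilbert_space"
  assumes T: "\<And>i. i \<in> I \<Longrightarrow> clinear_op (T i)" and c: "0 \<le> c"
    and le: "\<And>x. (\<Sum>i\<in>I. (norm (blinfun_apply (T i) x))\<^sup>2) \<le> (c * norm x)\<^sup>2"
  shows "norm (\<Sum>i\<in>I. cadjoint (T i) o\<^sub>L T i) \<le> c\<^sup>2"
proof (rule norm_blinfun_bound)
  let ?Q = "\<Sum>i\<in>I. cadjoint (T i) o\<^sub>L T i"
  fix y
  have L2: "L2_set (\<lambda>i. norm (blinfun_apply (T i) x)) I \<le> c * norm x" for x
    unfolding L2_set_def using le[of x] c by (simp add: real_le_lsqrt sum_nonneg)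
  show "norm (blinfun_apply ?Q y) \<le> c\<^sup>2 * norm y"
  proof (cases "blinfun_apply ?Q y = 0")
    case False
    define q where "q = blinfun_apply ?Q y"
    have "norm q * norm q = inner q (blinfun_apply ?Q y)"
      by (simp add: q_def power2_norm_eq_inner[symmetric] power2_eq_square)
    also have "\<dots> = (\<Sum>i\<in>I. inner (blinfun_apply (T i) q) (blinfun_apply (T i) y))"
      by (rule inner_sum_cadjoint_comp[OF T])
    also have "\<dots> \<le> (\<Sum>i\<in>I. \<bar>norm (blinfun_apply (T i) q)\<bar> * \<bar>norm (blinfun_apply (T i) y)\<bar>)"
      by (intro sum_mono) (simp add: norm_cauchy_schwarz)
    also have "\<dots> \<le> L2_set (\<lambda>i. norm (blinfun_apply (T i) q)) I
        * L2_set (\<lambda>i. norm (blinfun_apply (T i) y)) I"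
      by (rule L2_set_mult_ineq)
    also have "\<dots> \<le> (c * norm q) * (c * norm y)"
      by (intro mult_mono L2 mult_nonneg_nonneg c) simp_all
    finally show ?thesis
      using False by (simp add: q_def power2_eq_square mult_ac)
  qed simp
qed simp

section \<open>Operators on square summable families\<close>

lemma summable_norm_square_blinfun:
  assumes "(\<lambda>i. (norm (f i))\<^sup>2) summable_on UNIV"
  shows "(\<lambda>i. (norm (blinfun_apply T (f i)))\<^sup>2) summable_on UNIV"
proof (rule summable_on_comparison_test)
  show "(\<lambda>i. (norm T)\<^sup>2 * (norm (f i))\<^sup>2) summable_on UNIV"
    by (intro summable_on_cmult_right assms)
  show "(norm (blinfun_apply T (f i)))\<^sup>2 \<le> (norm T)\<^sup>2 * (norm (f i))\<^sup>2" for i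
    unfolding power_mult_distrib[symmetric] by (intro power_mono norm_blinfun) simp
qed simp

text \<open>In the model \<open>ell2_tensor\<close> this is \<open>T \<otimes> 1\<close>, applied to
  each coordinate. The bare map comes first because the lift to bounded operators needs its norm
  bound.\<close>

lift_definition ell2_map_fun ::
    "('a::chilbert_space \<Rightarrow>\<^sub>L 'b::chilbert_space) \<Rightarrow> ('i, 'a) ell2 \<Rightarrow> ('i, 'b) ell2"
  is "\<lambda>T f i. blinfun_apply T (f i)"
  by (rule summable_norm_square_blinfun)

lift_definition ell2_map ::
    "('a::chilbert_space \<Rightarrow>\<^sub>L 'b::chilbert_space) \<Rightarrow> ('i, 'a) ell2 \<Rightarrow>\<^sub>L ('i, 'b) ell2"
  is ell2_map_fun
proof (rule bounded_linear_intro)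
  fix T :: "'a \<Rightarrow>\<^sub>L 'b" and f g :: "('i, 'a) ell2" and r :: real
  show "ell2_map_fun T (f + g) = ell2_map_fun T f + ell2_map_fun T g"
    by transfer (simp add: blinfun.add_right)
  show "ell2_map_fun T (r *\<^sub>R f) = r *\<^sub>R ell2_map_fun T f"
    by transfer (simp add: blinfun.scaleR_right)
  have "(norm (blinfun_apply T (coord f i)))\<^sup>2 \<le> (norm T)\<^sup>2 * (norm (coord f i))\<^sup>2" for i
    unfolding power_mult_distrib[symmetric] by (intro power_mono norm_blinfun) simp
  then have "(norm (ell2_map_fun T f))\<^sup>2 \<le> (\<Sum>\<^sub>\<infinity>i. (norm T)\<^sup>2 * (norm (coord f i))\<^sup>2)"
    unfolding ell2_norm_square ell2_map_fun.rep_eq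
    by (intro infsum_mono summable_norm_square_blinfun square_summable_coord
        summable_on_cmult_right)
  also have "\<dots> = (norm f * norm T)\<^sup>2"
    by (simp add: infsum_cmult_right' ell2_norm_square power_mult_distrib)
  finally show "norm (ell2_map_fun T f) \<le> norm f * norm T"
    by (rule power2_le_imp_le) simp
qed

lemma coord_ell2_map: "coord (blinfun_apply (ell2_map T) f) i = blinfun_apply T (coord f i)"
  by (simp add: ell2_map.rep_eq ell2_map_fun.rep_eq)

text \<open>For a non-injective index map the result is the junk value \<open>0\<close>.\<close>

lift_definition ell2_push_fun :: "('i \<Rightarrow> 'j) \<Rightarrow> ('i, 'a::chilbert_space) ell2 \<Rightarrow> ('j, 'a) ell2"
  is "\<lambda>h f j. if inj h \<and> j \<in> range h then f (inv h j) else 0"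
proof -
  fix h :: "'i \<Rightarrow> 'j" and f :: "'i \<Rightarrow> 'a"
  assume f: "(\<lambda>i. (norm (f i))\<^sup>2) summable_on UNIV"
  let ?g = "\<lambda>j. if inj h \<and> j \<in> range h then f (inv h j) else 0"
  show "(\<lambda>j. (norm (?g j))\<^sup>2) summable_on UNIV"
  proof (cases "inj h")
    case True
    have "(\<lambda>j. (norm (?g j))\<^sup>2) summable_on range h"
      by (subst summable_on_reindex) (use f True in \<open>simp_all add: o_def\<close>)
    then show ?thesis
      by (rule summable_on_cong_neutral[THEN iffD1, rotated -1]) auto
  qed simp
qed

lemma norm_ell2_push_fun:
  assumes "inj h" shows "norm (ell2_push_fun h f) = norm f"
proof -
  have "(norm (ell2_push_fun h f))\<^sup>2 = (\<Sum>\<^sub>\<infinity>j\<in>range h. (norm (coord (ell2_push_fun h f) j))\<^sup>2)"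
    unfolding ell2_norm_square
    by (rule infsum_cong_neutral) (auto simp: ell2_push_fun.rep_eq)
  also have "\<dots> = (norm f)\<^sup>2"
    unfolding ell2_norm_square
    by (subst infsum_reindex) (simp_all add: assms o_def ell2_push_fun.rep_eq)
  finally show ?thesis by simp
qed

text \<open>For \<open>h = (@) w\<close> this is the product of creation operators along
  \<open>w\<close>: on scalar families the operator itself, on vector-valued ones its tensor product
  with the identity.\<close>

lift_definition ell2_push :: "('i \<Rightarrow> 'j) \<Rightarrow> ('i, 'a::chilbert_space) ell2 \<Rightarrow>\<^sub>L ('j, 'a) ell2"
  is ell2_push_fun
proof (rule bounded_linear_intro)
  fix h :: "'i \<Rightarrow> 'j" and f g :: "('i, 'a) ell2" and r :: real
  show "ell2_push_fun h (f + g) = ell2_push_fun h f + ell2_push_fun h g"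
    by transfer auto
  show "ell2_push_fun h (r *\<^sub>R f) = r *\<^sub>R ell2_push_fun h f"
    by transfer auto
  have "ell2_push_fun h f = 0" if "\<not> inj h"
    using that by transfer simp
  then show "norm (ell2_push_fun h f) \<le> norm f * 1"
    by (cases "inj h") (simp_all add: norm_ell2_push_fun)
qed

lemma coord_ell2_push:
  "inj h \<Longrightarrow> coord (blinfun_apply (ell2_push h) f) j = (if j \<in> range h then coord f (inv h j) else 0)"
  by (simp add: ell2_push.rep_eq ell2_push_fun.rep_eq)

lemma norm_ell2_push: "inj h \<Longrightarrow> norm (blinfun_apply (ell2_push h) f) = norm f"
  by (simp add: ell2_push.rep_eq norm_ell2_push_fun)

lemma ell2_push_comp:
  assumes "inj h" "inj h'"
  shows "blinfun_apply (ell2_push h) (blinfun_apply (ell2_push h') f)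
    = blinfun_apply (ell2_push (h \<circ> h')) f"
  unfolding coord_inject[symmetric]
proof
  fix j
  show "coord (blinfun_apply (ell2_push h) (blinfun_apply (ell2_push h') f)) j
    = coord (blinfun_apply (ell2_push (h \<circ> h')) f) j"
  proof (cases "j \<in> range (h \<circ> h')")
    case True
    then obtain i where i: "j = (h \<circ> h') i" by blast
    have "inv (h \<circ> h') j = i" unfolding i by (rule inv_f_f) (intro inj_compose assms)
    then show ?thesis
      using assms by (simp add: coord_ell2_push inj_compose i)
  next
    case False
    then have "inv h j \<notin> range h'" if "j \<in> range h"
      using that assms(1) by (auto simp: inv_f_f)
    with False show ?thesis
      using assms by (simp add: coord_ell2_push inj_compose)
  qed
qed

lemma ell2_push_basis:
  "inj h \<Longrightarrow> blinfun_apply (ell2_push h) (ell2_basis i) = ell2_basis (h i)"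
  unfolding coord_inject[symmetric]
  by (auto simp: fun_eq_iff coord_ell2_push ell2_basis.rep_eq inv_f_f inj_eq)

text \<open>The two families have disjoint supports, so every summand of their inner product
  vanishes.\<close>

lemma orthogonal_ell2_push:
  assumes "inj h" "inj h'" "range h \<inter> range h' = {}"
  shows "inner (blinfun_apply (ell2_push h) f) (blinfun_apply (ell2_push h') g) = 0"
proof -
  have "cinner (coord (blinfun_apply (ell2_push h) f) j) (coord (blinfun_apply (ell2_push h') g) j) = 0" for j
    using assms by (auto simp: coord_ell2_push cinner_zero_left cinner_zero_right)
  then show ?thesis
    by (simp add: Re_cinner[symmetric] cinner_ell2.rep_eq)
qed

text \<open>This identifies the composite as a tensor product operator. Complex linearity lets
  \<open>T\<close> pass the scalar coordinates of \<open>f\<close>.\<close>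

lemma ell2_push_map_tensor:
  assumes "inj h" "clinear_op T"
  shows "blinfun_apply (ell2_push h o\<^sub>L ell2_map T) (ell2_tensor x f)
    = ell2_tensor (blinfun_apply T x) (blinfun_apply (ell2_push h) f)"
  unfolding coord_inject[symmetric] using assms(2)
  by (auto simp: fun_eq_iff coord_ell2_push[OF assms(1)] coord_ell2_map ell2_tensor.rep_eq clinear_op_def
      scaleC_of_real[of 0, simplified])

lemma infsum_sum_finite:
  fixes f :: "'i \<Rightarrow> 'j \<Rightarrow> real"
  assumes "\<And>i. i \<in> I \<Longrightarrow> f i summable_on UNIV"
  shows "(\<Sum>i\<in>I. infsum (f i) UNIV) = (\<Sum>\<^sub>\<infinity>j. \<Sum>i\<in>I. f i j)"
    and "(\<lambda>j. \<Sum>i\<in>I. f i j) summable_on UNIV"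
  using assms
  by (induction I rule: infinite_finite_induct) (auto simp: infsum_add summable_on_add)

text \<open>The summands of the image of \<open>f\<close> are pairwise orthogonal, so their squared
  norms add up. Since each push is isometric, the sums can be exchanged and
  \<open>sum_norm_square_le\<close> applied at every coordinate of \<open>f\<close>.\<close>

lemma norm_sum_ell2_push_map_le:
  fixes A :: "'s \<Rightarrow> 'a::chilbert_space \<Rightarrow>\<^sub>L 'a" and h :: "'s \<Rightarrow> 'i \<Rightarrow> 'j"
  assumes I: "finite I" and h: "\<And>s. s \<in> I \<Longrightarrow> inj (h s)"
    and A: "\<And>s. s \<in> I \<Longrightarrow> clinear_op (A s)"
    and disj: "\<And>s s'. s \<in> I \<Longrightarrow> s' \<in> I \<Longrightarrow> s \<noteq> s' \<Longrightarrow> range (h s) \<inter> range (h s') = {}"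
  shows "norm (\<Sum>s\<in>I. ell2_push (h s) o\<^sub>L ell2_map (A s))
    \<le> sqrt (norm (\<Sum>s\<in>I. cadjoint (A s) o\<^sub>L A s))"
proof (rule norm_blinfun_bound)
  let ?Q = "\<Sum>s\<in>I. cadjoint (A s) o\<^sub>L A s"
  fix f :: "('i, 'a) ell2"
  let ?C = "\<lambda>s. blinfun_apply (ell2_push (h s)) (blinfun_apply (ell2_map (A s)) f)"
  have summable: "(\<lambda>i. (norm (blinfun_apply (A s) (coord f i)))\<^sup>2) summable_on UNIV" for s
    by (rule summable_norm_square_blinfun) (rule square_summable_coord)
  have "(norm (\<Sum>s\<in>I. ?C s))\<^sup>2 = (\<Sum>s\<in>I. (norm (?C s))\<^sup>2)"
    by (intro norm_sum_Pythagorean I)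
      (simp add: pairwise_def orthogonal_def orthogonal_ell2_push h disj)
  also have "\<dots> = (\<Sum>s\<in>I. \<Sum>\<^sub>\<infinity>i. (norm (blinfun_apply (A s) (coord f i)))\<^sup>2)"
    by (intro sum.cong refl) (simp only: norm_ell2_push h ell2_norm_square coord_ell2_map)
  also have "\<dots> = (\<Sum>\<^sub>\<infinity>i. \<Sum>s\<in>I. (norm (blinfun_apply (A s) (coord f i)))\<^sup>2)"
    by (rule infsum_sum_finite(1)[OF summable])
  also have "\<dots> \<le> (\<Sum>\<^sub>\<infinity>i. norm ?Q * (norm (coord f i))\<^sup>2)"
    by (intro infsum_mono infsum_sum_finite(2)[OF summable] sum_norm_square_le A
        summable_on_cmult_right square_summable_coord)
  also have "\<dots> = (sqrt (norm ?Q) * norm f)\<^sup>2"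
    by (simp only: infsum_cmult_right' ell2_norm_square power_mult_distrib
        real_sqrt_pow2 norm_ge_zero)
  finally show "norm (blinfun_apply (\<Sum>s\<in>I. ell2_push (h s) o\<^sub>L ell2_map (A s)) f)
      \<le> sqrt (norm ?Q) * norm f"
    unfolding blinfun.sum_left blinfun_apply_blinfun_compose
    by (rule power2_le_imp_le) simp
qed simp

section \<open>Coordinates of a tensor product with a space of families\<close>

text \<open>Two bounded operators agree on a closed set, and elementary tensors have dense span. The
  codomain is a general normed space so that real functionals are covered as well.\<close>

lemma hilbert_tensor_dense_eqI:
  fixes T T' :: "'c::chilbert_space \<Rightarrow>\<^sub>L 'd::real_normed_vector"
  assumes t: "hilbert_tensor t"
    and eq: "\<And>x y. blinfun_apply T (t x y) = blinfun_apply T' (t x y)"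
  shows "T = T'"
proof (rule blinfun_eqI)
  fix z
  let ?S = "{t x y | x y. True}"
  have "blinfun_apply T z = blinfun_apply T' z" if "z \<in> span ?S" for z
    by (rule linear_eq_on[OF _ _ that])
      (use eq in \<open>auto intro: bounded_linear.linear blinfun.bounded_linear_right\<close>)
  then have "span ?S \<subseteq> {z. blinfun_apply T z = blinfun_apply T' z}" by blast
  moreover have "closed {z. blinfun_apply T z = blinfun_apply T' z}"
    by (intro closed_Collect_eq continuous_intros)
  ultimately have "closure (span ?S) \<subseteq> {z. blinfun_apply T z = blinfun_apply T' z}"
    by (rule closure_minimal)
  moreover have "z \<in> closure (span ?S)" using t unfolding hilbert_tensor_def by simp
  ultimately show "blinfun_apply T z = blinfun_apply T' z" by blast
qed

text \<open>This evaluates the definite description: \<open>T\<close> witnesses existence, density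
  gives uniqueness.\<close>

lemma tensor_op_eqI:
  assumes "hilbert_tensor t"
    and "\<And>x y. blinfun_apply T (t x y) = t (blinfun_apply A x) (blinfun_apply X y)"
  shows "tensor_op t A X = T"
  unfolding tensor_op_def
proof (rule the_equality)
  fix T' assume "\<forall>x y. blinfun_apply T' (t x y) = t (blinfun_apply A x) (blinfun_apply X y)"
  then show "T' = T"
    by (intro hilbert_tensor_dense_eqI[OF assms(1)]) (simp add: assms(2))
qed (use assms(2) in blast)

lemma norm_hilbert_tensor:
  assumes "hilbert_tensor t"
  shows "norm (t x y) = norm x * norm y"
proof -
  have "complex_of_real ((norm (t x y))\<^sup>2) = cinner x x * cinner y y"
    using assms unfolding cinner_self[symmetric] hilbert_tensor_def by blast
  also have "\<dots> = complex_of_real ((norm x * norm y)\<^sup>2)"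
    by (simp add: cinner_self power_mult_distrib)
  finally show ?thesis unfolding of_real_eq_iff by simp
qed

lemma norm_ell2_basis: "norm (ell2_basis i) = 1"
proof -
  have "(norm (ell2_basis i))\<^sup>2 = (\<Sum>\<^sub>\<infinity>j\<in>{i}. 1)"
    unfolding ell2_norm_square by (rule infsum_cong_neutral) (auto simp: ell2_basis.rep_eq)
  then show ?thesis by (simp add: power2_eq_1_iff) (smt (verit) norm_ge_zero)
qed

lemma cinner_ell2_basis: "cinner f (ell2_basis i) = coord f i"
proof -
  have "cinner f (ell2_basis i) = (\<Sum>\<^sub>\<infinity>j\<in>{i}. coord f j)"
    unfolding cinner_ell2.rep_eq
    by (rule infsum_cong_neutral) (auto simp: ell2_basis.rep_eq cinner_complex_def)
  then show ?thesis by simp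
qed

text \<open>Bessel's inequality makes the family of coordinates square summable and \<open>V\<close>
  bounded. Isometry is checked on elementary tensors, where both sides have the same product
  formula, and extended by density.\<close>

lemma hilbert_tensor_coordinates:
  fixes t :: "'k::chilbert_space \<Rightarrow> ('i, complex) ell2 \<Rightarrow> 'c::chilbert_space"
  assumes t: "hilbert_tensor t"
  obtains V :: "'c \<Rightarrow>\<^sub>L ('i, 'k) ell2" where
    "clinear_op V" "\<And>z. norm (blinfun_apply V z) = norm z"
    "\<And>x f. blinfun_apply V (t x f) = ell2_tensor x f"
proof -
  have add: "t (x + x') f = t x f + t x' f"
    and scale: "t (c *\<^sub>C x) f = c *\<^sub>C t x f"
    and prod: "cinner (t x f) (t x' f') = cinner x x' * cinner f f'" for x x' f f' c
    using t unfolding hilbert_tensor_def by auto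
  define J where "J i = Blinfun (\<lambda>x. t x (ell2_basis i))" for i
  have J: "blinfun_apply (J i) x = t x (ell2_basis i)" for i x
    unfolding J_def
    by (subst bounded_linear_Blinfun_apply, rule bounded_linear_intro[where K = 1])
      (simp_all add: add norm_hilbert_tensor[OF t] norm_ell2_basis scale scaleC_of_real[symmetric])
  have clJ: "clinear_op (J i)" for i by (simp add: clinear_op_def J scale)
  define E where "E i = cadjoint (J i)" for i
  have E: "cinner z (t x (ell2_basis i)) = cinner (blinfun_apply (E i) z) x" for z x i
    using cadjoint[OF clJ[of i], of x z] unfolding J E_def by (metis cinner_commute)
  have Et: "blinfun_apply (E i) (t x f) = coord f i *\<^sub>C x" for i x f
  proof (rule cinner_eqI)
    show "cinner y (blinfun_apply (E i) (t x f)) = cinner y (coord f i *\<^sub>C x)" for y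
    proof -
      have "cinner (blinfun_apply (E i) (t x f)) y = cinner (coord f i *\<^sub>C x) y"
        by (simp add: E[symmetric] prod cinner_ell2_basis cinner_scaleC_left mult.commute)
      then show ?thesis by (metis cinner_commute)
    qed
  qed
  have bessel: "(\<Sum>i\<in>I. (norm (blinfun_apply (E i) z))\<^sup>2) \<le> (norm z)\<^sup>2" if I: "finite I" for I z
  proof -
    \<comment> \<open>\<open>p\<close> is the orthogonal projection of \<open>z\<close> onto the
      tensors supported on \<open>I\<close>. It has the same coordinates in \<open>I\<close> as
      \<open>z\<close>, so \<open>inner z p\<close> and \<open>inner p p\<close> are both the sum to
      be bounded.\<close>
    define p where "p = (\<Sum>i\<in>I. t (blinfun_apply (E i) z) (ell2_basis i))"
    have Ep: "blinfun_apply (E i) p = blinfun_apply (E i) z" if "i \<in> I" for i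
      using that I by (simp add: p_def blinfun.sum_right Et ell2_basis.rep_eq if_distrib[of "\<lambda>c. c *\<^sub>C _"]
          scaleC_one scaleC_of_real[of 0, simplified] cong: if_cong)
    have *: "inner u p = (\<Sum>i\<in>I. (norm (blinfun_apply (E i) z))\<^sup>2)"
      if "\<And>i. i \<in> I \<Longrightarrow> blinfun_apply (E i) u = blinfun_apply (E i) z" for u
    proof -
      have "inner u (t x (ell2_basis i)) = inner (blinfun_apply (E i) u) x" for i x
        by (metis E Re_cinner)
      then show ?thesis
        by (simp add: p_def inner_sum_right power2_norm_eq_inner that)
    qed
    have "0 \<le> inner (z - p) (z - p)" by simp
    also have "\<dots> = (norm z)\<^sup>2 - (\<Sum>i\<in>I. (norm (blinfun_apply (E i) z))\<^sup>2)"
      using *[of z] *[OF Ep]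
      by (simp add: inner_diff_left inner_diff_right inner_commute[of p z] power2_norm_eq_inner)
    finally show ?thesis by simp
  qed
  have sE: "(\<lambda>i. (norm (blinfun_apply (E i) z))\<^sup>2) summable_on UNIV" for z
    by (rule nonneg_bdd_above_summable_on) (use bessel in \<open>auto simp: bdd_above_def\<close>)
  define W where "W z = (Abs_ell2 (\<lambda>i. blinfun_apply (E i) z) :: ('i, 'k) ell2)" for z
  have W: "coord (W z) = (\<lambda>i. blinfun_apply (E i) z)" for z
    unfolding W_def using sE by (simp add: Abs_ell2_inverse)
  have bl: "bounded_linear W"
  proof (rule bounded_linear_intro)
    show "W (z + z') = W z + W z'" for z z'
      by (simp add: coord_inject[symmetric] plus_ell2.rep_eq W blinfun.add_right)
    show "W (r *\<^sub>R z) = r *\<^sub>R W z" for r z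
      by (simp add: coord_inject[symmetric] scaleR_ell2.rep_eq W blinfun.scaleR_right)
    show "norm (W z) \<le> norm z * 1" for z
    proof (rule power2_le_imp_le)
      show "(norm (W z))\<^sup>2 \<le> (norm z * 1)\<^sup>2"
        unfolding ell2_norm_square W
        by (rule infsum_le_finite_sums) (use sE bessel in auto)
    qed simp
  qed
  define V where "V = Blinfun W"
  have V: "blinfun_apply V = W" unfolding V_def by (rule bounded_linear_Blinfun_apply[OF bl])
  have Vt: "blinfun_apply V (t x f) = ell2_tensor x f" for x f
    by (simp add: coord_inject[symmetric] V W Et ell2_tensor.rep_eq)
  have cl: "clinear_op V"
    using clinear_op_cadjoint[OF clJ]
    by (simp add: clinear_op_def E_def[symmetric] coord_inject[symmetric] scaleC_ell2.rep_eq V W)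
  \<comment> \<open>Density is used in one argument at a time: first with \<open>u\<close> an
    elementary tensor, then, by symmetry, with arbitrary \<open>u\<close>.\<close>
  have inner_V: "inner (blinfun_apply V u) (blinfun_apply V z) = inner u z"
    if "\<And>y g. inner (blinfun_apply V u) (blinfun_apply V (t y g)) = inner u (t y g)" for u z
  proof -
    have "blinfun_inner_right (blinfun_apply V u) o\<^sub>L V = blinfun_inner_right u"
      by (rule hilbert_tensor_dense_eqI[OF t]) (simp add: that)
    from arg_cong[OF this, of "\<lambda>B. blinfun_apply B z"] show ?thesis by simp
  qed
  have "inner (blinfun_apply V (t x f)) (blinfun_apply V (t y g)) = inner (t x f) (t y g)" for x f y g
    using hilbert_tensor_ell2[where ?'a = 'k and ?'i = 'i]
    unfolding Vt Re_cinner[symmetric] prod hilbert_tensor_def by simp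
  then have "inner (blinfun_apply V (t x f)) (blinfun_apply V z) = inner (t x f) z" for x f z
    by (rule inner_V)
  then have "inner (blinfun_apply V z) (blinfun_apply V z) = inner z z" for z
    by - (rule inner_V, metis inner_commute)
  then have "norm (blinfun_apply V z) = norm z" for z
    by (simp add: norm_eq_sqrt_inner)
  from that[OF cl this Vt] show ?thesis .
qed

section \<open>The Fock space representation\<close>

lemma inj_append: "inj ((@) w)"
  by (simp add: inj_on_def)

text \<open>Each creation operator pushes along \<open>Cons i\<close>, so a word of them pushes
  along prepending that word; every letter contributes one factor \<open>\<rho>\<close>.\<close>

lemma word_op_creation:
  "blinfun_apply (word_op (\<lambda>i. \<rho> *\<^sub>R creation i) w) f = \<rho> ^ length w *\<^sub>R blinfun_apply (ell2_push ((@) w)) f"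
proof (induction w arbitrary: f)
  case Nil
  have "(@) [] = (id :: 'a list \<Rightarrow> 'a list)" by auto
  then show ?case
    by (simp add: coord_inject[symmetric] fun_eq_iff coord_ell2_push)
next
  case (Cons i w)
  have c: "blinfun_apply (creation i) g = blinfun_apply (ell2_push (Cons i)) g" for g :: "'a fock"
    by (auto simp: coord_inject[symmetric] fun_eq_iff coord_ell2_push creation.rep_eq
        creation_fun.rep_eq inv_f_f split: list.splits)
  have eq: "(@) (i # w) = (#) i \<circ> (@) w" by auto
  show ?case
    unfolding eq ell2_push_comp[OF inj_on_Cons1 inj_append, symmetric]
    by (simp add: Cons.IH c blinfun.scaleR_left blinfun.scaleR_right mult.commute)
qed

text \<open>A word has only one prefix of a given length. This makes the ranges of the creation
  operators of equal degree orthogonal.\<close>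

lemma ranges_append_disjoint:
  assumes "length w = length w'" "w \<noteq> w'"
  shows "range ((@) w) \<inter> range ((@) w') = {}"
  using assms by auto

lemma finite_words: "finite {w :: 'n::finite list. length w = k}"
  using finite_lists_length_eq[of "UNIV :: 'n set" k] by simp

text \<open>On an elementary tensor, \<open>V\<close> passes to the concrete model, where the
  operator acts as required, and \<open>cadjoint V\<close> leads back because it is a left inverse
  of \<open>V\<close>.\<close>

lemma tensor_op_creation:
  fixes t :: "'k::chilbert_space \<Rightarrow> 'n fock \<Rightarrow> 'c::chilbert_space"
  assumes t: "hilbert_tensor t" and A: "clinear_op A"
    and V: "clinear_op V" "\<And>z. norm (blinfun_apply V z) = norm z"
      "\<And>x f. blinfun_apply V (t x f) = ell2_tensor x f"
  shows "tensor_op t A (word_op (\<lambda>i. \<rho> *\<^sub>R creation i) w)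
    = \<rho> ^ length w *\<^sub>R (cadjoint V o\<^sub>L (ell2_push ((@) w) o\<^sub>L ell2_map A) o\<^sub>L V)"
proof (rule tensor_op_eqI[OF t])
  fix x f
  have scale: "t y (r *\<^sub>R g) = r *\<^sub>R t y g" for y r g
    using t unfolding hilbert_tensor_def scaleC_of_real[symmetric] by blast
  have "blinfun_apply (cadjoint V) (ell2_tensor y g) = t y g" for y g
    using isometry_cadjoint(1)[OF V(1,2)] by (metis V(3))
  then show "blinfun_apply (\<rho> ^ length w *\<^sub>R (cadjoint V o\<^sub>L (ell2_push ((@) w) o\<^sub>L ell2_map A) o\<^sub>L V)) (t x f)
      = t (blinfun_apply A x) (blinfun_apply (word_op (\<lambda>i. \<rho> *\<^sub>R creation i) w) f)"
    using ell2_push_map_tensor[OF inj_append A, of w x f]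
    by (simp add: blinfun.scaleR_left V(3) word_op_creation scale)
qed

section \<open>Norms of the homogeneous parts and convergence of the series\<close>

text \<open>The factors \<open>V\<close> and \<open>cadjoint V\<close> are contractions, and in
  between stands a sum over words of equal length, to which \<open>norm_sum_ell2_push_map_le\<close>
  applies.\<close>

lemma norm_homogeneous_part_le:
  fixes t :: "'k::chilbert_space \<Rightarrow> 'n::finite fock \<Rightarrow> 'c::chilbert_space"
  assumes t: "hilbert_tensor t" and A: "\<And>w. clinear_op (A w)" and \<rho>: "0 \<le> \<rho>"
  shows "norm (\<Sum>w | length w = k. tensor_op t (A w) (word_op (\<lambda>i. \<rho> *\<^sub>R creation i) w))
    \<le> \<rho> ^ k * sqrt (norm (coeff_square_sum A k))"
proof -
  obtain V where V: "clinear_op V" "\<And>z. norm (blinfun_apply V z) = norm z"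
    "\<And>x f. blinfun_apply V (t x f) = ell2_tensor x f"
    using hilbert_tensor_coordinates[OF t] by blast
  let ?C = "\<Sum>w | length w = k. ell2_push ((@) w) o\<^sub>L ell2_map (A w)"
  have "norm V \<le> 1"
    by (rule norm_blinfun_bound) (simp_all add: V(2))
  have "(\<Sum>w | length w = k. tensor_op t (A w) (word_op (\<lambda>i. \<rho> *\<^sub>R creation i) w))
      = \<rho> ^ k *\<^sub>R (cadjoint V o\<^sub>L ?C o\<^sub>L V)"
    by (rule blinfun_eqI)
      (simp add: tensor_op_creation[OF t A V] blinfun.sum_left blinfun.sum_right
        blinfun.scaleR_left scaleR_sum_right)
  also have "norm \<dots> \<le> \<rho> ^ k * (norm (cadjoint V) * norm ?C * norm V)"
    using \<rho> by (auto intro!: mult_left_mono norm_blinfun_compose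
        order_trans[OF norm_blinfun_compose] mult_right_mono)
  also have "\<dots> \<le> \<rho> ^ k * (1 * sqrt (norm (coeff_square_sum A k)) * 1)"
    unfolding coeff_square_sum_def
    by (intro mult_mono norm_sum_ell2_push_map_le finite_words A ranges_append_disjoint
        inj_append isometry_cadjoint(2) V \<open>norm V \<le> 1\<close>) (use \<rho> in auto)
  finally show ?thesis by simp
qed

text \<open>The growth condition in \<open>free_holomorphic\<close> concerns the coefficients alone,
  so it gives convergence for a tensor product \<open>t\<close> other than \<open>tH\<close>. The
  proof is a root test against a geometric series.\<close>

lemma summable_homogeneous_parts:
  fixes t :: "'k::chilbert_space \<Rightarrow> 'n::finite fock \<Rightarrow> 'c::chilbert_space"
  assumes t: "hilbert_tensor t" and F: "free_holomorphic tH \<gamma> A F" and \<rho>: "0 < \<rho>" "\<rho> < \<gamma>"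
  shows "summable (\<lambda>k. \<Sum>w | length w = k. tensor_op t (A w) (word_op (\<lambda>i. \<rho> *\<^sub>R creation i) w))"
proof -
  have "1 / \<gamma> < 1 / \<rho>" using \<rho> by (intro divide_strict_left_mono) auto
  \<comment> \<open>The lower bound puts \<open>r\<close> above the limes superior; the upper one
    makes the ratio \<open>\<rho> * r\<close> less than 1.\<close>
  then obtain r where r: "1 / \<gamma> < r" "r < 1 / \<rho>" using dense by blast
  have "0 < r" using r(1) \<rho> by (smt (verit) divide_pos_pos)
  have "limsup (\<lambda>k. ereal (norm (coeff_square_sum A k) powr (1 / (2 * real k)))) < ereal r"
    using F r(1) unfolding free_holomorphic_def by (auto intro: le_less_trans)
  then have "\<forall>\<^sub>F k in sequentially. ereal (norm (coeff_square_sum A k) powr (1 / (2 * real k))) < ereal r"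
    by (rule Limsup_lessD)
  then have "\<forall>\<^sub>F k in sequentially.
      norm (\<Sum>w | length w = k. tensor_op t (A w) (word_op (\<lambda>i. \<rho> *\<^sub>R creation i) w)) \<le> (\<rho> * r) ^ k"
    \<comment> \<open>At \<open>k = 0\<close> the exponent is 0, and the \<open>k\<close>-th power
      would not give back the square root.\<close>
    using eventually_gt_at_top[of 0]
  proof eventually_elim
    case (elim k)
    let ?q = "norm (coeff_square_sum A k)"
    have "sqrt ?q = ?q powr (1 / (2 * real k) * real k)"
      using elim(2) by (simp add: powr_half_sqrt)
    also have "\<dots> = (?q powr (1 / (2 * real k))) ^ k"
      using elim(2) by (subst powr_powr[symmetric]) (simp add: powr_realpow')
    also have "\<dots> \<le> r ^ k"
      using elim(1) by (intro power_mono) auto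
    finally have "\<rho> ^ k * sqrt ?q \<le> (\<rho> * r) ^ k"
      using \<rho> by (simp add: power_mult_distrib)
    moreover have "clinear_op (A w)" for w
      using F unfolding free_holomorphic_def by blast
    ultimately show ?case
      using norm_homogeneous_part_le[OF t, of A \<rho> k] \<rho> by simp
  qed
  then show ?thesis
    by (rule summable_comparison_test_ev, intro summable_geometric)
      (use r(2) \<rho> \<open>0 < r\<close> in \<open>simp add: abs_mult field_simps del: power_mult_distrib\<close>)
qed

text \<open>On the vacuum, the operator of a word \<open>v\<close> produces the basis vector at
  \<open>v\<close>. Hence the coordinate at \<open>w\<close> sees only the degree
  \<open>length w\<close> and, within it, only the word \<open>w\<close>.\<close>

lemma coord_free_series:
  fixes t :: "'k::chilbert_space \<Rightarrow> 'n::finite fock \<Rightarrow> 'c::chilbert_space"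
  assumes t: "hilbert_tensor t" and F: "free_holomorphic tH \<gamma> A F" and \<rho>: "0 < \<rho>" "\<rho> < \<gamma>"
    and V: "clinear_op V" "\<And>z. norm (blinfun_apply V z) = norm z"
      "\<And>x f. blinfun_apply V (t x f) = ell2_tensor x f"
  shows "coord (blinfun_apply V (blinfun_apply (free_series t A (\<lambda>i. \<rho> *\<^sub>R creation i))
      (t x (ell2_basis [])))) w = \<rho> ^ length w *\<^sub>R blinfun_apply (A w) x"
proof -
  let ?T = "\<lambda>k. \<Sum>w | length w = k. tensor_op t (A w) (word_op (\<lambda>i. \<rho> *\<^sub>R creation i) w)"
  have A: "clinear_op (A w)" for w using F unfolding free_holomorphic_def by blast
  have coord_bl: "bounded_linear (\<lambda>f :: ('n list, 'k) ell2. coord f w)"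
    by (rule bounded_linear_intro[where K = 1])
      (simp_all add: plus_ell2.rep_eq scaleR_ell2.rep_eq norm_coord_le)
  \<comment> \<open>Being bounded and linear in the operator \<open>B\<close>, this map can be
    applied to the norm convergent series term by term.\<close>
  have bl: "bounded_linear (\<lambda>B. coord (blinfun_apply V (blinfun_apply B (t x (ell2_basis [])))) w)"
    by (intro bounded_linear_compose[OF coord_bl] blinfun.bounded_linear_left
        bounded_linear_compose[OF blinfun.bounded_linear_right])
  have VT: "blinfun_apply V (blinfun_apply (tensor_op t (A v) (word_op (\<lambda>i. \<rho> *\<^sub>R creation i) v))
      (t x (ell2_basis []))) = \<rho> ^ length v *\<^sub>R ell2_tensor (blinfun_apply (A v) x) (ell2_basis v)" for v
  proof -
    have "blinfun_apply (cadjoint V) (ell2_tensor y g) = t y g" for y g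
      using isometry_cadjoint(1)[OF V(1,2)] by (metis V(3))
    then show ?thesis
      using ell2_push_map_tensor[OF inj_append A, of v v x "ell2_basis []"]
      by (simp add: tensor_op_creation[OF t A V] V(3) blinfun.scaleR_left blinfun.scaleR_right
          ell2_push_basis inj_append)
  qed
  have "(\<lambda>k. coord (blinfun_apply V (blinfun_apply (?T k) (t x (ell2_basis [])))) w)
      sums coord (blinfun_apply V (blinfun_apply (free_series t A (\<lambda>i. \<rho> *\<^sub>R creation i))
        (t x (ell2_basis [])))) w"
    unfolding free_series_def
    by (rule bounded_linear.sums[OF bl]) (rule summable_sums[OF summable_homogeneous_parts[OF t F \<rho>]])
  moreover have "coord (blinfun_apply V (blinfun_apply (?T k) (t x (ell2_basis [])))) w
      = (if k = length w then \<rho> ^ length w *\<^sub>R blinfun_apply (A w) x else 0)" for k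
  proof -
    have "coord (blinfun_apply V (blinfun_apply (?T k) (t x (ell2_basis [])))) w
      = (\<Sum>v | length v = k. if v = w then \<rho> ^ length v *\<^sub>R blinfun_apply (A v) x else 0)"
      unfolding blinfun.sum_left blinfun.sum_right coord_sum VT
      by (rule sum.cong)
        (auto simp: scaleR_ell2.rep_eq ell2_tensor.rep_eq ell2_basis.rep_eq scaleC_one
          scaleC_of_real[of 0, simplified])
    then show ?thesis by (auto simp: finite_words)
  qed
  moreover have "(\<lambda>k. if k = length w then \<rho> ^ length w *\<^sub>R blinfun_apply (A w) x else 0)
      sums (\<rho> ^ length w *\<^sub>R blinfun_apply (A w) x)"
    by (rule sums_single)
  ultimately show ?thesis using sums_unique2 by force
qed

text \<open>\<open>tH\<close> and \<open>tF\<close> are arbitrary models of the tensor products of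
  the coefficient space with \<open>'h\<close> and with the Fock space.\<close>

theorem theorem2p1:
  fixes \<gamma> :: real
    and A :: "'n::finite list \<Rightarrow> 'k::chilbert_space \<Rightarrow>\<^sub>L 'k"
    and tH :: "'k \<Rightarrow> 'h::chilbert_space \<Rightarrow> 'kh::chilbert_space"
    and F :: "('n \<Rightarrow> 'h \<Rightarrow>\<^sub>L 'h) \<Rightarrow> 'kh \<Rightarrow>\<^sub>L 'kh"
    and tF :: "'k \<Rightarrow> 'n fock \<Rightarrow> 'kf::chilbert_space"
    and M :: "real \<Rightarrow> real"
  assumes "0 < \<gamma>"
    and "hilbert_tensor tH"
    and "free_holomorphic tH \<gamma> A F"
    and "hilbert_tensor tF"
    and "\<And>\<rho>. 0 < \<rho> \<Longrightarrow> \<rho> < \<gamma> \<Longrightarrow> M \<rho> = norm (free_series tF A (\<lambda>i. \<rho> *\<^sub>R creation i))"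
  shows "\<forall>k. \<forall>\<rho>. 0 < \<rho> \<and> \<rho> < \<gamma> \<longrightarrow> sqrt (norm (coeff_square_sum A k)) \<le> 1 / \<rho> ^ k * M \<rho>"
proof (intro allI impI)
  fix k and \<rho> :: real
  assume "0 < \<rho> \<and> \<rho> < \<gamma>"
  then have \<rho>: "0 < \<rho>" "\<rho> < \<gamma>" by auto
  let ?F = "free_series tF A (\<lambda>i. \<rho> *\<^sub>R creation i)"
  let ?c = "1 / \<rho> ^ k * M \<rho>"
  have M: "M \<rho> = norm ?F" by (rule assms(5)[OF \<rho>])
  then have c: "0 \<le> ?c" using \<rho> by simp
  obtain V where V: "clinear_op V" "\<And>z. norm (blinfun_apply V z) = norm z"
    "\<And>x f. blinfun_apply V (tF x f) = ell2_tensor x f"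
    using hilbert_tensor_coordinates[OF assms(4)] by blast
  have "(\<Sum>w | length w = k. (norm (blinfun_apply (A w) x))\<^sup>2) \<le> (?c * norm x)\<^sup>2" for x
  proof -
    let ?z = "tF x (ell2_basis [])"
    have z: "norm ?z = norm x"
      by (simp add: norm_hilbert_tensor[OF assms(4)] norm_ell2_basis)
    have "(\<rho> ^ k)\<^sup>2 * (\<Sum>w | length w = k. (norm (blinfun_apply (A w) x))\<^sup>2)
        = (\<Sum>w | length w = k. (norm (coord (blinfun_apply V (blinfun_apply ?F ?z)) w))\<^sup>2)"
      unfolding coord_free_series[OF assms(4,3) \<rho> V] sum_distrib_left
      by (rule sum.cong) (auto simp: power_mult_distrib)
    \<comment> \<open>The words of length \<open>k\<close> form a finite set of coordinates, and
      \<open>V\<close> preserves the norm.\<close>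
    also have "\<dots> \<le> (norm (blinfun_apply ?F ?z))\<^sup>2"
      using ell2_finite_le_norm[OF finite_words] V(2) by metis
    also have "\<dots> \<le> (M \<rho> * norm x)\<^sup>2"
      unfolding M z[symmetric] by (intro power_mono norm_blinfun) simp
    finally show ?thesis
      using \<rho> by (simp add: power_mult_distrib power_divide field_simps)
  qed
  \<comment> \<open>The estimate for all \<open>x\<close> bounds the column of the coefficients of
    degree \<open>k\<close> by \<open>?c\<close>.\<close>
  then have "norm (coeff_square_sum A k) \<le> ?c\<^sup>2"
    unfolding coeff_square_sum_def using assms(3) c
    by (intro norm_sum_cadjoint_comp_le) (auto simp: free_holomorphic_def)
  then show "sqrt (norm (coeff_square_sum A k)) \<le> ?c"
    using c by (rule real_le_lsqrt[rotated])
qed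

end
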